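(* Let $n\ge1$. For every function $f(t)=\sum_{j=1}^n a_je^{\lambda_jt}$ with $a_j\in\mathbb{R}$ and real exponents $0\le\lambda_1<\lambda_2<\cdots<\lambda_n$, $$|f(0)| \le n\,\|f\|_{L_2[0,1]}.$$ This is sharp: the supremum of $|f(0)|/\|f\|_{L_2[0,1]}$ over all nonzero such $f$ equals $n$.
   Context: $\|f\|_{L_2[0,1]}=(\int_0^1|f(t)|^2dt)^{1/2}$. *)

theory Defs
  imports "HOL-Analysis.Analysis"
begin

definition exp_sum :: "nat \<Rightarrow> (nat \<Rightarrow> real) \<Rightarrow> (nat \<Rightarrow> real) \<Rightarrow> real \<Rightarrow> real" where
  "exp_sum n a lam t = (\<Sum>j<n. a j * exp (lam j * t))"

definition admissible_exps :: "nat \<Rightarrow> (nat \<Rightarrow> real) \<Rightarrow> bool" where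
  "admissible_exps n lam \<longleftrightarrow> (\<forall>j<n. 0 \<le> lam j) \<and> (\<forall>i j. i < j \<and> j < n \<longrightarrow> lam i < lam j)"

definition L2_norm01 :: "(real \<Rightarrow> real) \<Rightarrow> real" where
  "L2_norm01 f = sqrt (integral {0..1} (\<lambda>t. \<bar>f t\<bar>^2))"

end

theory Submission
  imports Defs "HOL-Real_Asymp.Real_Asymp"
begin

text \<open>For fixed exponents the ratio is largest for the sum \<open>f\<close> orthogonal to all sums vanishing at \<open>0\<close>, and
  orthogonality forces \<open>f\<close> to have \<open>n - 1\<close> zeros in \<open>(0,1)\<close>. Replacing the largest exponent of \<open>f\<close> by a
  smaller one, while keeping the zeros and the value at \<open>0\<close>, can only decrease \<open>\<bar>f\<bar>\<close> on \<open>[0,\<infinity>)\<close>: the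
  difference of the two sums has no further zeros, so its sign is determined at infinity. Exchanging all the
  exponents in this way for \<open>- \<epsilon>, \<dots>, - n \<epsilon>\<close> and letting \<open>\<epsilon> \<rightarrow> 0\<close> shows that \<open>\<bar>f\<bar>\<close> dominates the polynomial
  of degree \<open>n - 1\<close> with the same zeros and the same value at \<open>0\<close>. For polynomials the inequality follows
  from an explicit reproducing kernel \<open>K\<close> at \<open>0\<close> with \<open>K 0 = n\<^sup>2\<close>. It is sharp because
  \<open>K ((exp (\<epsilon> t) - 1) / \<epsilon>)\<close> is an admissible exponential sum converging to \<open>K\<close>.\<close>

section \<open>Nontrivial solutions of underdetermined linear systems\<close>

text \<open>Gaussian elimination, one equation per induction step: a zero row is dropped, otherwise
  a pivot \<open>e0\<close> eliminates one unknown from the other rows. This supplies both sums with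
  prescribed zeros and the orthogonal sum.\<close>

lemma underdetermined_system:
  fixes A :: "'i \<Rightarrow> 'e \<Rightarrow> real"
  assumes "finite I" "finite E" "card I < card E"
  shows "\<exists>c. (\<exists>e\<in>E. c e \<noteq> 0) \<and> (\<forall>i\<in>I. (\<Sum>e\<in>E. A i e * c e) = 0)"
  using assms
proof (induction I arbitrary: E A rule: finite_induct)
  case empty
  then show ?case by (intro exI[of _ "\<lambda>_. 1"]) (auto simp: card_gt_0_iff)
next
  case (insert i I)
  show ?case
  proof (cases "\<forall>e\<in>E. A i e = 0")
    case True
    have "card I < card E" using insert by simp
    from insert.IH[OF insert.prems(1) this, of A]
    obtain c where c: "\<exists>e\<in>E. c e \<noteq> 0" "\<forall>i\<in>I. (\<Sum>e\<in>E. A i e * c e) = 0" by blast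
    have "(\<Sum>e\<in>E. A i e * c e) = 0" using True by (intro sum.neutral) simp
    with c show ?thesis by (intro exI[of _ c]) simp
  next
    case False
    then obtain e0 where e0: "e0 \<in> E" "A i e0 \<noteq> 0" by blast
    define E' where "E' = E - {e0}"
    have fin: "finite E'" and card: "card I < card E'" and e0n: "e0 \<notin> E'"
      using insert e0 by (auto simp: E'_def)
    have E: "E = insert e0 E'" using e0 by (auto simp: E'_def)
    obtain c where c: "\<exists>e\<in>E'. c e \<noteq> 0"
      "\<And>j. j \<in> I \<Longrightarrow> (\<Sum>e\<in>E'. (A j e - A j e0 * A i e / A i e0) * c e) = 0"
      using insert.IH[OF fin card, of "\<lambda>j e. A j e - A j e0 * A i e / A i e0"] by blast
    define c' where "c' = c(e0 := - (\<Sum>e\<in>E'. A i e * c e) / A i e0)"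
    have sum': "(\<Sum>e\<in>E. A j e * c' e) = A j e0 * c' e0 + (\<Sum>e\<in>E'. A j e * c e)" for j
      unfolding E using fin e0n by (auto simp: c'_def intro!: sum.cong)
    have "(\<Sum>e\<in>E. A j e * c' e) = 0" if "j \<in> insert i I" for j
    proof (cases "j = i")
      case True
      then show ?thesis unfolding sum' using e0 by (simp add: c'_def)
    next
      case False
      then have "j \<in> I" using that by simp
      from c(2)[OF this] have "(\<Sum>e\<in>E'. A j e * c e) = A j e0 / A i e0 * (\<Sum>e\<in>E'. A i e * c e)"
        by (simp add: algebra_simps sum_subtractf sum_distrib_left sum_divide_distrib)
      then show ?thesis unfolding sum' by (simp add: c'_def)
    qed
    moreover have "\<exists>e\<in>E. c' e \<noteq> 0" using c(1) e0n unfolding E c'_def by (auto split: if_splits)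
    ultimately show ?thesis by blast
  qed
qed

subsection \<open>Zeros of exponential sums\<close>

text \<open>Indexing coefficients by the exponents themselves makes the exponents distinct, turns an
  exchange of exponents into a set operation and keeps derivatives over the same set.\<close>

definition expsum :: "real set \<Rightarrow> (real \<Rightarrow> real) \<Rightarrow> real \<Rightarrow> real" where
  "expsum E a t = (\<Sum>l\<in>E. a l * exp (l * t))"

lemma expsum_has_derivative:
  "(expsum E a has_real_derivative expsum E (\<lambda>l. l * a l) t) (at t within S)"
  unfolding expsum_def by (auto intro!: derivative_eq_intros sum.cong simp: mult_ac)

lemma continuous_on_expsum [continuous_intros]: "continuous_on S (expsum E a)"
  unfolding expsum_def by (intro continuous_intros)

lemma isCont_expsum: "isCont (expsum E a) t"
  using expsum_has_derivative DERIV_isCont by blast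

lemma expsum_cmult: "expsum E (\<lambda>l. c * a l) t = c * expsum E a t"
  by (simp add: expsum_def sum_distrib_left mult_ac)

lemma expsum_diff: "expsum E (\<lambda>l. a l - b l) t = expsum E a t - expsum E b t"
  by (simp add: expsum_def sum_subtractf algebra_simps)

text \<open>Rolle's theorem gives a zero of \<open>g'\<close> strictly between consecutive points of
  \<open>Z\<close>, hence outside \<open>Z\<close>. The bound by \<open>Max Z\<close> ensures in the
  induction that the zero found in the last gap is new.\<close>

lemma Rolle_zero_set:
  fixes g :: "real \<Rightarrow> real"
  assumes "finite Z" "Z \<noteq> {}" "\<And>z. z \<in> Z \<Longrightarrow> g z = 0"
    and der: "\<And>x. (g has_real_derivative g' x) (at x)"
  shows "\<exists>W. finite W \<and> card W = card Z - 1 \<and> W \<inter> Z = {} \<and> W \<subseteq> {..Max Z} \<and> (\<forall>w\<in>W. g' w = 0)"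
  using assms(1-3)
proof (induction Z rule: finite_linorder_max_induct)
  case empty
  then show ?case by simp
next
  case (insert b A)
  show ?case
  proof (cases "A = {}")
    case True
    then show ?thesis by (intro exI[of _ "{}"]) auto
  next
    case False
    then obtain W where W: "finite W" "card W = card A - 1" "W \<inter> A = {}" "W \<subseteq> {..Max A}"
      "\<forall>w\<in>W. g' w = 0" using insert by auto
    have MA: "Max A \<in> A" "Max A < b" using insert False by auto
    have "\<exists>w>Max A. w < b \<and> g' w = 0"
    proof -
      have "continuous_on {Max A..b} g"
        using der by (meson DERIV_isCont continuous_at_imp_continuous_on)
      then obtain w where "Max A < w" "w < b" "(g has_real_derivative 0) (at w)"
        using Rolle[of "Max A" b g] MA insert.prems der
        by (auto simp: real_differentiable_def)
      then show ?thesis using der DERIV_unique by blast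
    qed
    then obtain w where w: "Max A < w" "w < b" "g' w = 0" by blast
    have wn: "w \<notin> W" "w \<notin> A" using w W insert.hyps by (auto dest: Max_ge)
    have "b \<notin> W" using W(4) MA(2) by (meson atMost_iff linorder_not_le subsetD)
    have "b \<notin> A" using insert.hyps by auto
    have "card (insert w W) = card (insert b A) - 1"
      using W wn \<open>b \<notin> A\<close> insert.hyps False by (simp add: card_gt_0_iff Suc_diff_Suc)
    moreover have "Max (insert b A) = b" using insert.hyps by (intro Max_eqI) auto
    moreover have "insert w W \<inter> insert b A = {}" using W(3) wn \<open>b \<notin> W\<close> w by blast
    moreover have "W \<subseteq> {..b}" using W(4) MA(2) by (meson atMost_subset_iff less_imp_le order_trans)
    ultimately show ?thesis
      using W(1,5) w(2,3) by (intro exI[of _ "insert w W"]) simp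
  qed
qed

text \<open>A Descartes-type count: each differentiation costs one exponent and at most one zero.
  The set \<open>D\<close> of double zeros makes the count see multiplicity two, which later yields
  simplicity of zeros.\<close>

lemma expsum_zero_count:
  assumes "finite E" "\<exists>l\<in>E. a l \<noteq> 0" "finite Z" "\<And>z. z \<in> Z \<Longrightarrow> expsum E a z = 0"
    "D \<subseteq> Z" "\<And>z. z \<in> D \<Longrightarrow> expsum E (\<lambda>l. l * a l) z = 0"
  shows "card Z + card D < card E"
  using assms
proof (induction E arbitrary: a Z D rule: finite_induct)
  case empty
  then show ?case by simp
next
  case (insert m E)
  define b where "b = (\<lambda>l. (l - m) * a l)"
  have b: "expsum E b t = expsum (insert m E) (\<lambda>l. l * a l) t - m * expsum (insert m E) a t" for t
    using insert.hyps
    by (simp add: expsum_def b_def sum_subtractf algebra_simps sum_distrib_left)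
  show ?case
  proof (cases "\<exists>l\<in>E. b l \<noteq> 0")
    case False
    then have "\<forall>l\<in>E. a l = 0" using insert.hyps by (auto simp: b_def)
    then have "expsum (insert m E) a t = a m * exp (m * t)" "a m \<noteq> 0" for t
      using insert by (auto simp: expsum_def intro!: sum.neutral)
    then have "Z = {}" using insert.prems by auto
    then show ?thesis using insert by auto
  next
    case True
    show ?thesis
    proof (cases "Z = {}")
      case True
      then show ?thesis using insert by auto
    next
      case False
      \<comment> \<open>Differentiating \<open>exp (- m t) f t\<close> removes the exponent \<open>m\<close>; the double zeros in \<open>D\<close> survive and are
        disjoint from the intermediate zeros given by Rolle's theorem.\<close>
      define g where "g = (\<lambda>t. exp (- m * t) * expsum (insert m E) a t)"
      have g: "(g has_real_derivative exp (- m * t) * expsum E b t) (at t)" for t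
        unfolding g_def b
        by (auto intro!: derivative_eq_intros expsum_has_derivative simp: algebra_simps)
      obtain W where W: "finite W" "card W = card Z - 1" "W \<inter> Z = {}"
        "\<forall>w\<in>W. exp (- m * w) * expsum E b w = 0"
        using Rolle_zero_set[of Z g, OF _ _ _ g] insert.prems False by (auto simp: g_def)
      have fD: "finite D" using insert.prems finite_subset by blast
      have "expsum E b z = 0" if "z \<in> W \<union> D" for z
        using that W insert.prems b by auto
      then have "card (W \<union> D) + card {} < card E"
        using insert.IH[of b "W \<union> D" "{}"] True W fD by auto
      moreover have "card (W \<union> D) = card W + card D"
        using W fD insert.prems by (intro card_Un_disjoint) auto
      moreover have "card Z > 0" using False insert.prems by (simp add: card_gt_0_iff)
      ultimately show ?thesis using W insert.hyps by simp
    qed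
  qed
qed

lemma expsum_zeros_finite:
  assumes "finite E" "\<exists>l\<in>E. a l \<noteq> 0"
  shows "finite {t. expsum E a t = 0}"
proof (rule ccontr)
  assume "infinite {t. expsum E a t = 0}"
  then obtain Z where "finite Z" "card Z = card E" "Z \<subseteq> {t. expsum E a t = 0}"
    by (metis infinite_arbitrarily_large)
  then show False using expsum_zero_count[OF assms, of Z "{}"] by auto
qed

lemma expsum_vanishing_exists:
  assumes "finite E" "finite Z" "card Z < card E"
  obtains b where "\<exists>l\<in>E. b l \<noteq> 0" "\<And>z. z \<in> Z \<Longrightarrow> expsum E b z = 0"
  using underdetermined_system[OF assms(2,1,3), of "\<lambda>z l. exp (l * z)"]
  by (auto simp: expsum_def mult.commute)

text \<open>The points of \<open>Z\<close> exhaust the zero count, which leaves no room for a double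
  or a further zero.\<close>

lemma expsum_simple_zeros:
  assumes "finite E" "\<exists>l\<in>E. a l \<noteq> 0" "finite Z" "\<And>z. z \<in> Z \<Longrightarrow> expsum E a z = 0"
    "card E = Suc (card Z)"
  shows "z \<in> Z \<Longrightarrow> expsum E (\<lambda>l. l * a l) z \<noteq> 0" "expsum E a t = 0 \<longleftrightarrow> t \<in> Z"
proof -
  show "expsum E (\<lambda>l. l * a l) z \<noteq> 0" if "z \<in> Z"
    using expsum_zero_count[OF assms(1-4), of "{z}"] assms(5) that by auto
  show "expsum E a t = 0 \<longleftrightarrow> t \<in> Z"
  proof
    assume "expsum E a t = 0"
    then show "t \<in> Z"
      using expsum_zero_count[OF assms(1,2), of "insert t Z" "{}"] assms(3-5)
      by (cases "t \<in> Z") auto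
  qed (use assms in auto)
qed

subsection \<open>Local and global signs\<close>

text \<open>Expresses that there is no sign change at \<open>s\<close>. The inequalities are weak so
  that even zeros qualify; a sign change is expressed by the same property of
  \<open>(x - s) * F x\<close>.\<close>

definition locally_signed :: "(real \<Rightarrow> real) \<Rightarrow> real \<Rightarrow> bool" where
  "locally_signed F s \<longleftrightarrow> (\<forall>\<^sub>F x in nhds s. F x \<ge> 0) \<or> (\<forall>\<^sub>F x in nhds s. F x \<le> 0)"

lemma locally_signed_mult:
  assumes "locally_signed F s" "locally_signed G s"
  shows "locally_signed (\<lambda>x. F x * G x) s"
proof -
  have pos: "\<forall>\<^sub>F x in nhds s. F x * G x \<ge> 0"
    if "\<forall>\<^sub>F x in nhds s. F x \<ge> 0 \<and> G x \<ge> 0 \<or> F x \<le> 0 \<and> G x \<le> 0"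
    using that by (rule eventually_mono) (auto simp: zero_le_mult_iff)
  have neg: "\<forall>\<^sub>F x in nhds s. F x * G x \<le> 0"
    if "\<forall>\<^sub>F x in nhds s. F x \<ge> 0 \<and> G x \<le> 0 \<or> F x \<le> 0 \<and> G x \<ge> 0"
    using that by (rule eventually_mono) (auto simp: mult_le_0_iff)
  consider "\<forall>\<^sub>F x in nhds s. F x \<ge> 0" "\<forall>\<^sub>F x in nhds s. G x \<ge> 0"
    | "\<forall>\<^sub>F x in nhds s. F x \<ge> 0" "\<forall>\<^sub>F x in nhds s. G x \<le> 0"
    | "\<forall>\<^sub>F x in nhds s. F x \<le> 0" "\<forall>\<^sub>F x in nhds s. G x \<ge> 0"
    | "\<forall>\<^sub>F x in nhds s. F x \<le> 0" "\<forall>\<^sub>F x in nhds s. G x \<le> 0"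
    using assms unfolding locally_signed_def by blast
  then show ?thesis
  proof cases
    case 1
    then have "\<forall>\<^sub>F x in nhds s. F x \<ge> 0 \<and> G x \<ge> 0 \<or> F x \<le> 0 \<and> G x \<le> 0"
      by eventually_elim simp
    then show ?thesis unfolding locally_signed_def by (intro disjI1 pos)
  next
    case 2
    then have "\<forall>\<^sub>F x in nhds s. F x \<ge> 0 \<and> G x \<le> 0 \<or> F x \<le> 0 \<and> G x \<ge> 0"
      by eventually_elim simp
    then show ?thesis unfolding locally_signed_def by (intro disjI2 neg)
  next
    case 3
    then have "\<forall>\<^sub>F x in nhds s. F x \<ge> 0 \<and> G x \<le> 0 \<or> F x \<le> 0 \<and> G x \<ge> 0"
      by eventually_elim simp
    then show ?thesis unfolding locally_signed_def by (intro disjI2 neg)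
  next
    case 4
    then have "\<forall>\<^sub>F x in nhds s. F x \<ge> 0 \<and> G x \<ge> 0 \<or> F x \<le> 0 \<and> G x \<le> 0"
      by eventually_elim simp
    then show ?thesis unfolding locally_signed_def by (intro disjI1 pos)
  qed
qed

lemma locally_signed_nonzero:
  assumes "isCont F s" "F s \<noteq> 0"
  shows "locally_signed F s"
proof (cases "F s > 0")
  case True
  then have "\<forall>\<^sub>F x in nhds s. F x > 0"
    using assms by (simp add: isCont_def tendsto_at_iff_tendsto_nhds order_tendstoD)
  then show ?thesis unfolding locally_signed_def by (auto elim: eventually_mono)
next
  case False
  then have "\<forall>\<^sub>F x in nhds s. F x < 0"
    using assms by (simp add: isCont_def tendsto_at_iff_tendsto_nhds order_tendstoD)
  then have "\<forall>\<^sub>F x in nhds s. F x \<le> 0" by (rule eventually_mono) simp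
  then show ?thesis unfolding locally_signed_def ..
qed

text \<open>The difference quotient tends to \<open>d\<close>, so near \<open>s\<close> it keeps the
  sign of \<open>d\<close>.\<close>

lemma locally_signed_simple_zero:
  assumes "(F has_real_derivative d) (at s)" "F s = 0" "d \<noteq> 0"
  shows "locally_signed (\<lambda>x. (x - s) * F x) s"
proof -
  have "((\<lambda>x. F x / (x - s)) \<longlongrightarrow> d) (at s)"
    using assms by (simp add: has_field_derivative_iff)
  then have "(\<forall>\<^sub>F x in at s. F x / (x - s) > 0) \<or> (\<forall>\<^sub>F x in at s. F x / (x - s) < 0)"
    using order_tendstoD[of _ d "at s" 0] assms(3) by (cases "d > 0") auto
  then have "(\<forall>\<^sub>F x in at s. (x - s) * F x \<ge> 0) \<or> (\<forall>\<^sub>F x in at s. (x - s) * F x \<le> 0)"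
  proof
    assume "\<forall>\<^sub>F x in at s. F x / (x - s) > 0"
    then have "\<forall>\<^sub>F x in at s. (x - s) * F x \<ge> 0"
      by (rule eventually_mono) (auto simp: zero_less_divide_iff zero_le_mult_iff)
    then show ?thesis ..
  next
    assume "\<forall>\<^sub>F x in at s. F x / (x - s) < 0"
    then have "\<forall>\<^sub>F x in at s. (x - s) * F x \<le> 0"
      by (rule eventually_mono) (auto simp: divide_less_0_iff mult_le_0_iff)
    then show ?thesis ..
  qed
  then show ?thesis using assms(2)
    unfolding locally_signed_def eventually_nhds_conv_at by auto
qed

text \<open>Two sign changes cancel: the product of the hypotheses carries the factor
  \<open>(x - s)\<^sup>2\<close>, which is positive off \<open>s\<close>, and \<open>F s = 0\<close>
  settles the point \<open>s\<close> itself.\<close>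

lemma locally_signed_mult_odd:
  assumes "locally_signed (\<lambda>x. (x - s) * F x) s" "locally_signed (\<lambda>x. (x - s) * G x) s" "F s = 0"
  shows "locally_signed (\<lambda>x. F x * G x) s"
proof -
  have "locally_signed (\<lambda>x. (x - s)\<^sup>2 * (F x * G x)) s"
    using locally_signed_mult[OF assms(1,2)] by (simp add: power2_eq_square mult_ac)
  moreover have "F x * G x \<ge> 0" if "(x - s)\<^sup>2 * (F x * G x) \<ge> 0" for x
    using that assms(3) by (cases "x = s") (auto simp: zero_le_mult_iff)
  moreover have "F x * G x \<le> 0" if "(x - s)\<^sup>2 * (F x * G x) \<le> 0" for x
    using that assms(3) by (cases "x = s") (auto simp: mult_le_0_iff)
  ultimately show ?thesis unfolding locally_signed_def 
    by (elim disjE) (rule disjI1 disjI2, erule eventually_mono, assumption)+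
qed

text \<open>The points near which \<open>F \<ge> 0\<close> and those near which \<open>F \<le> 0\<close> form two open sets covering \<open>S\<close>; they
  are disjoint because the zeros of \<open>F\<close> are isolated.\<close>
lemma locally_signed_imp_signed:
  assumes "open S" "connected S" "finite {x\<in>S. F x = 0}" "\<And>s. s \<in> S \<Longrightarrow> locally_signed F s"
  shows "(\<forall>x\<in>S. F x \<ge> 0) \<or> (\<forall>x\<in>S. F x \<le> 0)"
proof -
  define A where "A = {s. \<forall>\<^sub>F x in nhds s. F x \<ge> 0}"
  define B where "B = {s. \<forall>\<^sub>F x in nhds s. F x \<le> 0}"
  have "open A" "open B"
    unfolding A_def B_def by (auto simp: open_subopen[of "Collect _"] eventually_nhds)
  moreover have "S \<subseteq> A \<union> B" using assms(4) by (auto simp: A_def B_def locally_signed_def)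
  moreover have "A \<inter> B \<inter> S = {}"
  proof (rule ccontr)
    assume "A \<inter> B \<inter> S \<noteq> {}"
    then obtain s where s: "s \<in> A" "s \<in> B" "s \<in> S" by blast
    have "\<forall>\<^sub>F x in nhds s. x \<in> S" using assms(1) s by (simp add: eventually_nhds_in_open)
    with s(1,2) have "\<forall>\<^sub>F x in nhds s. x \<in> {x\<in>S. F x = 0}"
      unfolding A_def B_def mem_Collect_eq by eventually_elim auto
    then obtain U where "open U" "s \<in> U" "U \<subseteq> {x\<in>S. F x = 0}"
      by (auto simp: eventually_nhds)
    from this(3) assms(3) have "finite U" by (rule finite_subset)
    then show False using \<open>open U\<close> \<open>s \<in> U\<close> 
      using islimpt_UNIV[of s] by (auto simp: islimpt_eq_acc_point)
  qed
  ultimately have "A \<inter> S = {} \<or> B \<inter> S = {}" using connectedD[OF assms(2)] by blast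
  then have "S \<subseteq> A \<or> S \<subseteq> B" using \<open>S \<subseteq> A \<union> B\<close> by blast
  then show ?thesis unfolding A_def B_def using eventually_nhds_x_imp_x by blast
qed

subsection \<open>Exchanging exponents\<close>

lemma expsum_extend:
  "finite F \<Longrightarrow> E \<subseteq> F \<Longrightarrow> expsum F (\<lambda>l. if l \<in> E then a l else 0) t = expsum E a t"
  unfolding expsum_def by (rule sum.mono_neutral_cong_right) auto

lemma expsum_locally_signed_simple_zero:
  assumes "expsum E a s = 0" "expsum E (\<lambda>l. l * a l) s \<noteq> 0"
  shows "locally_signed (\<lambda>x. (x - s) * expsum E a x) s"
  using locally_signed_simple_zero[OF expsum_has_derivative] assms by blast

text \<open>All exponents but the largest contribute decaying terms. A nonzero leading coefficient
  thus fixes the sign at infinity.\<close>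

lemma expsum_at_top:
  assumes "finite E" "E \<noteq> {}"
  shows "((\<lambda>t. expsum E a t * exp (- (Max E * t))) \<longlongrightarrow> a (Max E)) at_top"
proof -
  have "((\<lambda>t. a l * exp ((l - Max E) * t)) \<longlongrightarrow> (if l = Max E then a l else 0)) at_top"
    if "l \<in> E" for l
  proof (cases "l = Max E")
    case False
    then have "l - Max E < 0" using that assms by (simp add: order_neq_le_trans)
    then have "((\<lambda>t. exp ((l - Max E) * t)) \<longlongrightarrow> 0) at_top" by real_asymp
    then show ?thesis using False by (auto intro: tendsto_mult_right_zero)
  qed simp
  then have "((\<lambda>t. \<Sum>l\<in>E. a l * exp ((l - Max E) * t)) \<longlongrightarrow> (\<Sum>l\<in>E. if l = Max E then a l else 0)) at_top"
    by (rule tendsto_sum)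
  moreover have "(\<Sum>l\<in>E. if l = Max E then a l else 0) = a (Max E)"
    using assms by simp
  moreover have "(\<Sum>l\<in>E. a l * exp ((l - Max E) * t)) = expsum E a t * exp (- (Max E * t))" for t
    by (simp add: expsum_def sum_distrib_right left_diff_distrib exp_diff exp_minus divide_inverse mult.assoc)
  ultimately show ?thesis by simp
qed

text \<open>Choose \<open>g\<close> over \<open>E'\<close> with the zeros \<open>Z\<close> and the
  value \<open>f 0\<close>. Then \<open>u = f - g\<close> has one exponent more than there are
  points in \<open>insert 0 Z\<close>, so it vanishes only there, and simply. Comparing its sign
  with that of \<open>f\<close> puts \<open>g\<close> between 0 and \<open>f\<close> on
  \<open>[0, \<infinity>)\<close>.\<close>

lemma expsum_exchange_max:
  fixes Z E :: "real set"
  assumes E: "finite E" and Z: "finite Z" "\<And>z. z \<in> Z \<Longrightarrow> z > 0" and card: "card E = Suc (card Z)"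
    and nz: "\<exists>l\<in>E. a l \<noteq> 0" and zero: "\<And>z. z \<in> Z \<Longrightarrow> expsum E a z = 0"
    and mu: "mu \<notin> E" "mu < Max E"
  defines "E' \<equiv> insert mu (E - {Max E})"
  obtains b where "\<exists>l\<in>E'. b l \<noteq> 0" "\<And>z. z \<in> Z \<Longrightarrow> expsum E' b z = 0"
    "expsum E' b 0 = expsum E a 0"
    "\<And>t. t \<ge> 0 \<Longrightarrow> \<bar>expsum E' b t\<bar> \<le> \<bar>expsum E a t\<bar>"
proof -
  have "E \<noteq> {}" using card by auto
  then have M: "Max E \<in> E" using E by simp
  \<comment> \<open>Otherwise only \<open>card Z\<close> exponents would carry a nonzero sum with
    \<open>card Z\<close> zeros.\<close>
  have aM: "a (Max E) \<noteq> 0"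
  proof
    assume aM: "a (Max E) = 0"
    then have "expsum (E - {Max E}) a t = expsum E a t" for t
      using E M by (simp add: expsum_def sum_diff1)
    moreover have "\<exists>l\<in>E - {Max E}. a l \<noteq> 0" using nz aM by auto
    ultimately show False
      using expsum_zero_count[of "E - {Max E}" a Z "{}"] E M Z zero card by auto
  qed
  have E': "finite E'" "card E' = Suc (card Z)" "Max E \<notin> E'"
    using E mu card M by (auto simp: E'_def)
  obtain b0 where b0: "\<exists>l\<in>E'. b0 l \<noteq> 0" "\<And>z. z \<in> Z \<Longrightarrow> expsum E' b0 z = 0"
    using expsum_vanishing_exists[of E' Z] E' Z by (metis lessI)
  define f where "f = expsum E a"
  have f_iff: "f t = 0 \<longleftrightarrow> t \<in> Z" for t
    unfolding f_def using expsum_simple_zeros(2)[OF E nz Z(1) zero card] .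
  have "0 \<notin> Z" using Z by auto
  have b00: "expsum E' b0 0 \<noteq> 0"
    using expsum_simple_zeros(2)[OF E'(1) b0(1) Z(1) b0(2) E'(2)] \<open>0 \<notin> Z\<close> by simp
  define c where "c = f 0 / expsum E' b0 0"
  have c: "c \<noteq> 0" using b00 f_iff \<open>0 \<notin> Z\<close> by (simp add: c_def)
  define b where "b = (\<lambda>l. c * b0 l)"
  define g where "g = expsum E' b"
  have g: "g t = c * expsum E' b0 t" for t by (simp add: g_def b_def expsum_cmult)
  have b_nz: "\<exists>l\<in>E'. b l \<noteq> 0" and gZ: "\<And>z. z \<in> Z \<Longrightarrow> expsum E' b z = 0"
    using b0 c g by (auto simp: b_def g_def)
  have g_iff: "g t = 0 \<longleftrightarrow> t \<in> Z" for t
    unfolding g_def using expsum_simple_zeros(2)[OF E'(1) b_nz Z(1) gZ E'(2)] .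
  have g0: "g 0 = f 0" using b00 by (simp add: g c_def)
  define F where "F = insert mu E"
  define d where "d = (\<lambda>l. (if l \<in> E then a l else 0) - (if l \<in> E' then b l else 0))"
  define u where "u = expsum F d"
  have F: "finite F" "E \<subseteq> F" "E' \<subseteq> F" using E by (auto simp: F_def E'_def)
  have u: "u t = f t - g t" for t
    unfolding u_def d_def f_def g_def expsum_diff using F by (simp add: expsum_extend)
  \<comment> \<open>The removed exponent is absent from \<open>g\<close> and still the largest in
    \<open>F\<close>, so \<open>u\<close> inherits its leading coefficient from
    \<open>f\<close>.\<close>
  have dM: "d (Max E) = a (Max E)" using M E' by (simp add: d_def)
  have MF: "Max F = Max E"
    using E M mu by (intro Max_eqI) (auto simp: F_def)
  have d_nz: "\<exists>l\<in>F. d l \<noteq> 0"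
    using dM aM M F(2) by (intro bexI[of _ "Max E"]) auto
  have uZ: "u z = 0" if "z \<in> insert 0 Z" for z
    using that f_iff[of z] g_iff[of z] g0 by (auto simp: u)
  have cardF: "card F = Suc (card (insert 0 Z))"
    using E mu card Z \<open>0 \<notin> Z\<close> by (simp add: F_def)
  have u_iff: "u t = 0 \<longleftrightarrow> t \<in> insert 0 Z" for t
    unfolding u_def
    using expsum_simple_zeros(2)[OF F(1) d_nz _ uZ[unfolded u_def] cardF] Z(1) by simp
  have cont: "isCont f s" "isCont g s" "isCont u s" for s
    by (simp_all add: f_def g_def u_def isCont_expsum)
  have f_odd: "locally_signed (\<lambda>x. (x - s) * f x) s" if "s \<in> Z" for s
    unfolding f_def using expsum_simple_zeros(1)[OF E nz Z(1) zero card that] zero that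
    by (intro expsum_locally_signed_simple_zero) auto
  have g_odd: "locally_signed (\<lambda>x. (x - s) * g x) s" if "s \<in> Z" for s
    unfolding g_def using expsum_simple_zeros(1)[OF E'(1) b_nz Z(1) gZ E'(2) that] gZ that
    by (intro expsum_locally_signed_simple_zero) auto
  have u_odd: "locally_signed (\<lambda>x. (x - s) * u x) s" if "s \<in> insert 0 Z" for s
    unfolding u_def
    using expsum_simple_zeros(1)[OF F(1) d_nz _ uZ[unfolded u_def] cardF that] uZ[OF that] Z(1)
    by (intro expsum_locally_signed_simple_zero) (auto simp: u_def)
  have x_signed: "locally_signed (\<lambda>x. x) s" if "s \<noteq> 0" for s
    using that by (intro locally_signed_nonzero) auto

  \<comment> \<open>All zeros of \<open>H\<close> are double, so \<open>H\<close> has constant sign; since \<open>f\<close> and \<open>u = f - g\<close> have the same leading term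
    at infinity, the sign is positive.\<close>
  define H where "H = (\<lambda>x. x * (f x * u x))"
  have H_signed: "locally_signed H s" for s
  proof -
    consider "s = 0" | "s \<in> Z" | "s \<noteq> 0" "s \<notin> Z" by blast
    then show ?thesis
    proof cases
      case 1
      then have "locally_signed (\<lambda>x. f x * ((x - s) * u x)) s"
        using f_iff \<open>0 \<notin> Z\<close>
        by (intro locally_signed_mult[OF locally_signed_nonzero[OF cont(1)] u_odd]) auto
      then show ?thesis using 1 by (simp add: H_def mult_ac)
    next
      case 2
      then have "s \<noteq> 0" "f s = 0" using \<open>0 \<notin> Z\<close> f_iff by auto
      have "locally_signed (\<lambda>x. f x * u x) s"
        using 2 \<open>f s = 0\<close> locally_signed_mult_odd[OF f_odd u_odd] by blast
      then show ?thesis unfolding H_def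
        by (rule locally_signed_mult[OF x_signed[OF \<open>s \<noteq> 0\<close>]])
    next
      case 3
      then have "H s \<noteq> 0" using f_iff u_iff by (simp add: H_def)
      moreover have "isCont H s" unfolding H_def using cont by (intro continuous_intros)
      ultimately show ?thesis by (simp add: locally_signed_nonzero)
    qed
  qed
  have "{x\<in>UNIV. H x = 0} = insert 0 Z" by (auto simp: H_def f_iff u_iff)
  then have "(\<forall>x\<in>UNIV. H x \<ge> 0) \<or> (\<forall>x\<in>UNIV. H x \<le> 0)"
    using H_signed Z by (intro locally_signed_imp_signed) auto
  moreover have "\<exists>x. H x > 0"
  proof -
    have "((\<lambda>t. (f t * exp (- (Max E * t))) * (u t * exp (- (Max E * t)))) \<longlongrightarrow> a (Max E) * a (Max E)) at_top"
      using expsum_at_top[OF E \<open>E \<noteq> {}\<close>, of a] expsum_at_top[OF F(1), of d] d_nz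
      unfolding MF dM f_def u_def by (intro tendsto_mult) auto
    moreover have "a (Max E) * a (Max E) > 0" using aM by (auto simp: zero_less_mult_iff)
    ultimately have "\<forall>\<^sub>F t in at_top. (f t * exp (- (Max E * t))) * (u t * exp (- (Max E * t))) > 0"
      by (rule order_tendstoD)
    with eventually_gt_at_top[of 0]
    have "\<forall>\<^sub>F t in at_top. H t > 0"
      by eventually_elim (auto simp: H_def zero_less_mult_iff mult_less_0_iff)
    then show ?thesis by (meson eventually_happens trivial_limit_at_top_linorder)
  qed
  ultimately have H: "H x \<ge> 0" for x by (meson UNIV_I not_less)

  \<comment> \<open>Both \<open>f\<close> and \<open>g\<close> vanish exactly on \<open>Z\<close>,
    and simply, so their product never changes sign; at 0 it is positive.\<close>
  have "locally_signed (\<lambda>x. f x * g x) s" for s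
  proof (cases "s \<in> Z")
    case True
    then show ?thesis using f_iff locally_signed_mult_odd[OF f_odd g_odd] by blast
  next
    case False
    then show ?thesis
      using f_iff g_iff locally_signed_mult[OF locally_signed_nonzero[OF cont(1)] locally_signed_nonzero[OF cont(2)]]
      by blast
  qed
  moreover have "{x\<in>UNIV. f x * g x = 0} = Z" by (auto simp: f_iff g_iff)
  ultimately have "(\<forall>x\<in>UNIV. f x * g x \<ge> 0) \<or> (\<forall>x\<in>UNIV. f x * g x \<le> 0)"
    using Z by (intro locally_signed_imp_signed) auto
  moreover have "f 0 * g 0 > 0"
    using g0 f_iff[of 0] \<open>0 \<notin> Z\<close> by (auto simp: zero_less_mult_iff)
  ultimately have fg: "f x * g x \<ge> 0" for x by (meson UNIV_I not_less)

  have "\<bar>g t\<bar> \<le> \<bar>f t\<bar>" if "t \<ge> 0" for t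
  proof (cases "t = 0 \<or> f t = 0")
    case True
    then show ?thesis using f_iff[of t] g_iff[of t] g0 by auto
  next
    case False
    then have "f t * u t \<ge> 0" using H[of t] that by (simp add: H_def zero_le_mult_iff)
    \<comment> \<open>Here \<open>f t * u t \<ge> 0\<close> reads
      \<open>f t * g t \<le> f t * f t\<close>, and the left side is nonnegative.\<close>
    then have "\<bar>f t\<bar> * \<bar>g t\<bar> \<le> \<bar>f t\<bar> * \<bar>f t\<bar>"
      using fg[of t] by (simp add: u algebra_simps flip: abs_mult)
    then show ?thesis by (rule mult_left_le_imp_le) (use False in simp)
  qed
  then show ?thesis using that[of b] b_nz gZ g0 unfolding f_def g_def by blast
qed

text \<open>Iterates the single exchange: \<open>L\<close> holds the old exponents that remain, and
  each step trades the largest of them for one new element of \<open>T\<close>.\<close>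

lemma expsum_exchange:
  fixes Z E T :: "real set"
  assumes E: "finite E" and Z: "finite Z" "\<And>z. z \<in> Z \<Longrightarrow> z > 0" and card: "card E = Suc (card Z)"
    and nz: "\<exists>l\<in>E. a l \<noteq> 0" and zero: "\<And>z. z \<in> Z \<Longrightarrow> expsum E a z = 0"
    and T: "finite T" "card T \<le> card E" "\<And>x y. x \<in> T \<Longrightarrow> y \<in> E \<Longrightarrow> x < y"
  shows "\<exists>L b. L \<subseteq> E \<and> card L + card T = card E \<and> (\<exists>l\<in>L \<union> T. b l \<noteq> 0) \<and>
    (\<forall>z\<in>Z. expsum (L \<union> T) b z = 0) \<and> expsum (L \<union> T) b 0 = expsum E a 0 \<and>
    (\<forall>t\<ge>0. \<bar>expsum (L \<union> T) b t\<bar> \<le> \<bar>expsum E a t\<bar>)"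
  using T
proof (induction T rule: finite_induct)
  case empty
  then show ?case using nz zero by (intro exI[of _ E] exI[of _ a]) auto
next
  case (insert m T)
  then have "\<exists>L b. L \<subseteq> E \<and> card L + card T = card E \<and> (\<exists>l\<in>L \<union> T. b l \<noteq> 0) \<and>
    (\<forall>z\<in>Z. expsum (L \<union> T) b z = 0) \<and> expsum (L \<union> T) b 0 = expsum E a 0 \<and>
    (\<forall>t\<ge>0. \<bar>expsum (L \<union> T) b t\<bar> \<le> \<bar>expsum E a t\<bar>)" by simp
  then obtain L b where L: "L \<subseteq> E" "card L + card T = card E" "\<exists>l\<in>L \<union> T. b l \<noteq> 0"
    "\<And>z. z \<in> Z \<Longrightarrow> expsum (L \<union> T) b z = 0" "expsum (L \<union> T) b 0 = expsum E a 0"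
    "\<And>t. t \<ge> 0 \<Longrightarrow> \<bar>expsum (L \<union> T) b t\<bar> \<le> \<bar>expsum E a t\<bar>" by metis
  have finL: "finite L" using L(1) E finite_subset by blast
  have disj: "L \<inter> T = {}" using L(1) insert.prems(2) by fastforce
  have fin: "finite (L \<union> T)" using finL insert by simp
  have c: "card (L \<union> T) = Suc (card Z)"
    using card_Un_disjoint[OF finL insert.hyps(1) disj] L(2) card by simp
  have "card L > 0" using L(2) insert.prems(1) insert.hyps by simp
  then have ne: "L \<noteq> {}" by auto
  \<comment> \<open>As \<open>T\<close> lies below \<open>E\<close>, the exchange always removes an
    old exponent, never one inserted before.\<close>
  have Max: "Max (L \<union> T) = Max L"
  proof (rule Max_eqI[OF fin])
    show "Max L \<in> L \<union> T" using ne finL by simp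
    show "y \<le> Max L" if "y \<in> L \<union> T" for y
      using that ne finL insert.prems(2)[of y "Max L"] L(1)
      by (metis Max_ge Max_in Un_iff insertCI less_imp_le subsetD)
  qed
  have mem: "Max L \<in> L" using ne finL by simp
  have m: "m \<notin> L \<union> T" "m < Max (L \<union> T)"
    using insert.hyps insert.prems(2)[of m] L(1) mem unfolding Max by blast+
  have eq: "insert m (L \<union> T - {Max (L \<union> T)}) = (L - {Max L}) \<union> insert m T"
    using mem disj unfolding Max by blast
  obtain b' where b': "\<exists>l\<in>(L - {Max L}) \<union> insert m T. b' l \<noteq> 0"
    "\<And>z. z \<in> Z \<Longrightarrow> expsum ((L - {Max L}) \<union> insert m T) b' z = 0"
    "expsum ((L - {Max L}) \<union> insert m T) b' 0 = expsum (L \<union> T) b 0"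
    "\<And>t. t \<ge> 0 \<Longrightarrow> \<bar>expsum ((L - {Max L}) \<union> insert m T) b' t\<bar> \<le> \<bar>expsum (L \<union> T) b t\<bar>"
    using expsum_exchange_max[OF fin Z c L(3,4) m] unfolding eq by blast
  have "card (L - {Max L}) + card (insert m T) = card E"
    using mem finL insert.hyps L(2) \<open>card L > 0\<close> by simp
  moreover have "\<bar>expsum ((L - {Max L}) \<union> insert m T) b' t\<bar> \<le> \<bar>expsum E a t\<bar>" if "t \<ge> 0" for t
    using b'(4)[OF that] L(6)[OF that] by linarith
  moreover have "L - {Max L} \<subseteq> E" using L(1) by blast
  ultimately show ?case
    using L(5) b'(1-3) by (intro exI[of _ "L - {Max L}"] exI[of _ b']) simp
qed

text \<open>All exponents are exchanged for \<open>- \<epsilon>, - 2 \<epsilon>, \<dots>, - n \<epsilon>\<close>; the resulting sum is a polynomial in \<open>exp (- \<epsilon> t)\<close>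
  with known zeros.\<close>
lemma expsum_ge_exponential_product:
  fixes Z E :: "real set"
  assumes E: "finite E" "\<And>l. l \<in> E \<Longrightarrow> l \<ge> 0"
    and Z: "finite Z" "\<And>z. z \<in> Z \<Longrightarrow> z > 0" and card: "card E = Suc (card Z)"
    and nz: "\<exists>l\<in>E. a l \<noteq> 0" and zero: "\<And>z. z \<in> Z \<Longrightarrow> expsum E a z = 0"
    and "t \<ge> 0" "\<epsilon> > 0"
  shows "\<bar>expsum E a 0\<bar> * (exp (- \<epsilon> * t) *
    (\<Prod>z\<in>Z. \<bar>(exp (- \<epsilon> * t) - exp (- \<epsilon> * z)) / (1 - exp (- \<epsilon> * z))\<bar>)) \<le> \<bar>expsum E a t\<bar>"
proof -
  define n where "n = card E"
  \<comment> \<open>The shift by 1 keeps \<open>T\<close> strictly negative, hence below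
    \<open>E\<close> even if 0 is an exponent; it accounts for the extra factor
    \<open>exp (- \<epsilon> * t)\<close>.\<close>
  define T where "T = (\<lambda>j. - \<epsilon> * (real j + 1)) ` {..<n}"
  have inj: "inj_on (\<lambda>j. - \<epsilon> * (real j + 1)) {..<n}"
    using \<open>\<epsilon> > 0\<close> by (auto simp: inj_on_def)
  have T: "finite T" "card T = card E" using card_image[OF inj] by (auto simp: T_def n_def)
  have "x < y" if "x \<in> T" "y \<in> E" for x y
  proof -
    have "x < 0" using that(1) \<open>\<epsilon> > 0\<close> by (auto simp: T_def mult_neg_pos)
    then show ?thesis using E(2)[OF that(2)] by linarith
  qed
  then obtain L b where "L \<subseteq> E" "card L + card T = card E"
    "\<forall>z\<in>Z. expsum (L \<union> T) b z = 0" "expsum (L \<union> T) b 0 = expsum E a 0"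
    "\<forall>t\<ge>0. \<bar>expsum (L \<union> T) b t\<bar> \<le> \<bar>expsum E a t\<bar>"
    using expsum_exchange[OF E(1) Z card nz zero T(1)] T(2) by (metis order_refl)
  moreover from this have "L = {}" using T E by (auto dest: finite_subset)
  ultimately have b: "\<And>z. z \<in> Z \<Longrightarrow> expsum T b z = 0" "expsum T b 0 = expsum E a 0"
    "\<bar>expsum T b t\<bar> \<le> \<bar>expsum E a t\<bar>" using \<open>t \<ge> 0\<close> by auto
  define q where "q = (\<Sum>j<n. monom (b (- \<epsilon> * (real j + 1))) j)"
  have q: "expsum T b s = exp (- \<epsilon> * s) * poly q (exp (- \<epsilon> * s))" for s
    unfolding expsum_def T_def sum.reindex[OF inj] q_def poly_sum sum_distrib_left
    by (intro sum.cong) (auto simp: poly_monom algebra_simps exp_of_nat_mult[symmetric] exp_add[symmetric])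
  have n: "n = Suc (card Z)" using card by (simp add: n_def)
  have degq: "degree q < n"
    unfolding q_def n by (intro degree_sum_less le_less_trans[OF degree_monom_le]) auto
  define P where "P = (\<Prod>z\<in>Z. [:- exp (- \<epsilon> * z), 1:])"
  have P: "poly P x = (\<Prod>z\<in>Z. x - exp (- \<epsilon> * z))" for x
    by (simp add: P_def poly_prod)
  have P1: "poly P 1 \<noteq> 0" using Z \<open>\<epsilon> > 0\<close> by (auto simp: P)
  have degP: "degree P = card Z"
    unfolding P_def by (subst degree_prod_eq_sum_degree) auto
  have injZ: "inj_on (\<lambda>z. exp (- \<epsilon> * z)) Z" using \<open>\<epsilon> > 0\<close> by (auto simp: inj_on_def)
  have "1 \<notin> (\<lambda>z. exp (- \<epsilon> * z)) ` Z" using Z(2) \<open>\<epsilon> > 0\<close> by force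
  then have cardA: "card (insert 1 ((\<lambda>z. exp (- \<epsilon> * z)) ` Z)) = n"
    using Z(1) card_image[OF injZ] n by simp
  \<comment> \<open>Both sides have degree below \<open>n\<close> and agree at 1 and at the
    \<open>n - 1\<close> images of the zeros.\<close>
  have "q = smult (poly q 1 / poly P 1) P"
  proof (rule poly_eqI_degree)
    show "poly q x = poly (smult (poly q 1 / poly P 1) P) x"
      if x: "x \<in> insert 1 ((\<lambda>z. exp (- \<epsilon> * z)) ` Z)" for x
    proof (cases "x = 1")
      case False
      then obtain z where "z \<in> Z" "x = exp (- \<epsilon> * z)" using x by blast
      then have "poly q x = 0" "poly P x = 0" using b(1)[of z] q[of z] Z(1) by (auto simp: P)
      then show ?thesis by simp
    qed (use P1 in simp)
  qed (use cardA degq degP n in auto)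
  moreover have "poly q 1 = expsum E a 0" using q[of 0] b(2) by simp
  ultimately have "poly q x = expsum E a 0 * (poly P x / poly P 1)" for x
    by (metis poly_smult times_divide_eq_left times_divide_eq_right)
  moreover have "poly P x / poly P 1 = (\<Prod>z\<in>Z. (x - exp (- \<epsilon> * z)) / (1 - exp (- \<epsilon> * z)))" for x
    by (simp add: P prod_dividef)
  ultimately have "\<bar>expsum T b t\<bar> = \<bar>expsum E a 0\<bar> * (exp (- \<epsilon> * t) *
    (\<Prod>z\<in>Z. \<bar>(exp (- \<epsilon> * t) - exp (- \<epsilon> * z)) / (1 - exp (- \<epsilon> * z))\<bar>))"
    unfolding q by (simp add: abs_mult abs_prod)
  then show ?thesis using b(3) by simp
qed

text \<open>Let \<epsilon> tend to 0 from the right in the exponential product: the factor for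
  \<open>z\<close> tends to \<open>\<bar>1 - t / z\<bar>\<close>, the extra factor to 1.\<close>

lemma expsum_ge_polynomial_product:
  fixes Z E :: "real set"
  assumes E: "finite E" "\<And>l. l \<in> E \<Longrightarrow> l \<ge> 0"
    and Z: "finite Z" "\<And>z. z \<in> Z \<Longrightarrow> z > 0" and card: "card E = Suc (card Z)"
    and nz: "\<exists>l\<in>E. a l \<noteq> 0" and zero: "\<And>z. z \<in> Z \<Longrightarrow> expsum E a z = 0" and "t \<ge> 0"
  shows "\<bar>expsum E a 0\<bar> * (\<Prod>z\<in>Z. \<bar>1 - t / z\<bar>) \<le> \<bar>expsum E a t\<bar>"
proof (rule tendsto_upperbound)
  have "((\<lambda>\<epsilon>. (exp (- \<epsilon> * t) - exp (- \<epsilon> * z)) / (1 - exp (- \<epsilon> * z))) \<longlongrightarrow> 1 - t / z) (at_right 0)"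
    if "z > 0" for z
  proof -
    have "((\<lambda>\<epsilon>. (exp (- \<epsilon> * t) - exp (- \<epsilon> * z)) / (1 - exp (- \<epsilon> * z))) \<longlongrightarrow> (z - t) * inverse z) (at_right 0)"
      using that by real_asymp
    then show ?thesis using that by (simp add: left_diff_distrib divide_inverse)
  qed
  moreover have "((\<lambda>\<epsilon>. exp (- \<epsilon> * t)) \<longlongrightarrow> 1) (at_right 0)" by real_asymp
  ultimately have "((\<lambda>\<epsilon>. \<bar>expsum E a 0\<bar> * (exp (- \<epsilon> * t) *
    (\<Prod>z\<in>Z. \<bar>(exp (- \<epsilon> * t) - exp (- \<epsilon> * z)) / (1 - exp (- \<epsilon> * z))\<bar>))) \<longlongrightarrow>
    \<bar>expsum E a 0\<bar> * (1 * (\<Prod>z\<in>Z. \<bar>1 - t / z\<bar>))) (at_right 0)"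
    using Z by (intro tendsto_intros) auto
  then show "((\<lambda>\<epsilon>. \<bar>expsum E a 0\<bar> * (exp (- \<epsilon> * t) *
    (\<Prod>z\<in>Z. \<bar>(exp (- \<epsilon> * t) - exp (- \<epsilon> * z)) / (1 - exp (- \<epsilon> * z))\<bar>))) \<longlongrightarrow>
    \<bar>expsum E a 0\<bar> * (\<Prod>z\<in>Z. \<bar>1 - t / z\<bar>)) (at_right 0)"
    by simp
  show "\<forall>\<^sub>F \<epsilon> in at_right 0. \<bar>expsum E a 0\<bar> * (exp (- \<epsilon> * t) *
    (\<Prod>z\<in>Z. \<bar>(exp (- \<epsilon> * t) - exp (- \<epsilon> * z)) / (1 - exp (- \<epsilon> * z))\<bar>)) \<le> \<bar>expsum E a t\<bar>"
    using eventually_at_right_less[of 0]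
  proof eventually_elim
    case (elim \<epsilon>)
    show ?case
      using expsum_ge_exponential_product[OF E Z card nz zero \<open>t \<ge> 0\<close> elim] .
  qed
qed simp

subsection \<open>The extremal problem for polynomials\<close>

text \<open>The weights are the residues of \<open>R x / \<Prod>i<n. (x + i)\<close>, where \<open>R\<close> vanishes at \<open>2, \<dots>, n\<close> and is normalised
  so that the quotient is \<open>1\<close> at \<open>x = 1\<close>. They form the first column of the inverse Hilbert matrix.\<close>
lemma partial_fraction_weights:
  assumes "n \<ge> 1"
  obtains c :: "nat \<Rightarrow> real" where "c 0 = (real n)\<^sup>2"
    "\<And>k. k < n \<Longrightarrow> (\<Sum>j<n. c j / (real j + real k + 1)) = (if k = 0 then 1 else 0)"
proof -
  define R :: "real poly" where "R = smult (real n * (-1) ^ (n - 1)) (\<Prod>i\<in>{1..<n}. [:- (1 + real i), 1:])"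
  define D :: "nat \<Rightarrow> real poly" where "D = (\<lambda>j. \<Prod>i\<in>{..<n} - {j}. [:real i, 1:])"
  define c where "c = (\<lambda>j. poly R (- real j) / poly (D j) (- real j))"
  have R: "poly R x = real n * (-1) ^ (n - 1) * (\<Prod>i\<in>{1..<n}. x - (1 + real i))" for x
    by (simp add: R_def poly_prod algebra_simps)
  have D: "poly (D j) x = (\<Prod>i\<in>{..<n} - {j}. x + real i)" for j x
    by (simp add: D_def poly_prod add.commute)
  have D_nz: "poly (D j) (- real j) \<noteq> 0" for j by (auto simp: D)
  have degR: "degree R < n"
  proof -
    have "degree R \<le> (\<Sum>i\<in>{1..<n}. 1)"
      unfolding R_def by (intro order_trans[OF degree_smult_le] order_trans[OF degree_prod_sum_le]) auto
    then show ?thesis using assms by simp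
  qed
  have degD: "degree (D j) < n" if "j < n" for j
  proof -
    have "degree (D j) \<le> (\<Sum>i\<in>{..<n} - {j}. 1)"
      unfolding D_def by (intro order_trans[OF degree_prod_sum_le]) auto
    then show ?thesis using that by simp
  qed
  \<comment> \<open>The partial fraction decomposition with denominators cleared. At
    \<open>- m\<close> with \<open>m < n\<close> only \<open>D m\<close> survives, so both sides
    agree at \<open>n\<close> points.\<close>
  have "R = (\<Sum>j<n. smult (c j) (D j))"
  proof (rule poly_eqI_degree)
    show "poly R x = poly (\<Sum>j<n. smult (c j) (D j)) x" if x: "x \<in> (\<lambda>j. - real j) ` {..<n}" for x
    proof -
      obtain m where m: "m < n" "x = - real m" using x by blast
      have "poly (D j) x = 0" if "j \<in> {..<n} - {m}" for j
        using that m by (auto simp: D)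
      then have "(\<Sum>j<n. c j * poly (D j) x) = c m * poly (D m) x"
        using m(1) by (subst sum.remove[of _ m]) (auto intro!: sum.neutral)
      then show ?thesis using D_nz[of m] m by (simp add: poly_sum c_def)
    qed
    have "card ((\<lambda>j. - real j) ` {..<n}) = n" by (subst card_image) (auto simp: inj_on_def)
    then show "degree R < card ((\<lambda>j. - real j) ` {..<n})"
      "degree (\<Sum>j<n. smult (c j) (D j)) < card ((\<lambda>j. - real j) ` {..<n})"
      using degR assms by (auto intro!: degree_sum_less le_less_trans[OF degree_smult_le] degD)
  qed
  then have R_sum: "poly R x = (\<Sum>j<n. c j * poly (D j) x)" for x
    by (simp add: poly_sum)
  \<comment> \<open>Evaluate at \<open>k + 1\<close>: this is a root of \<open>R\<close> for
    \<open>0 < k < n\<close>, while for \<open>k = 0\<close> both \<open>R\<close> and the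
    denominator equal the factorial of \<open>n\<close>.\<close>
  have "(\<Sum>j<n. c j / (real j + real k + 1)) = (if k = 0 then 1 else 0)" if "k < n" for k
  proof -
    define N where "N = (\<Prod>i<n. real k + 1 + real i)"
    have "N > 0" unfolding N_def by (intro prod_pos) auto
    have "poly (D j) (real k + 1) = N / (real j + real k + 1)" if "j < n" for j
    proof -
      have "N = (real k + 1 + real j) * poly (D j) (real k + 1)"
        unfolding N_def D using that by (subst prod.remove[of _ j]) auto
      then show ?thesis by (simp add: field_simps)
    qed
    then have "poly R (real k + 1) = N * (\<Sum>j<n. c j / (real j + real k + 1))"
      unfolding R_sum sum_distrib_left by (intro sum.cong) auto
    moreover have "poly R (real k + 1) = (if k = 0 then N else 0)"
    proof (cases "k = 0")
      case False
      then have "(\<Prod>i\<in>{1..<n}. real k + 1 - (1 + real i)) = 0" using \<open>k < n\<close> by auto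
      then show ?thesis using False by (simp add: R)
    next
      case True
      have "(\<Prod>i\<in>{1..<n}. - real i) = (-1) ^ (n - 1) * (\<Prod>i\<in>{1..<n}. real i)"
        by (simp add: prod_uminus)
      moreover have "N = real n * (\<Prod>i\<in>{1..<n}. real i)"
      proof -
        have "N = (\<Prod>i\<in>{1..<Suc n}. real i)"
          unfolding N_def True using prod.shift_bounds_Suc_ivl[of real 0 n]
          by (simp add: atLeast0LessThan)
        then show ?thesis using assms by simp
      qed
      ultimately show ?thesis using True by (simp add: R flip: power_add)
    qed
    ultimately show ?thesis using \<open>N > 0\<close> by (auto split: if_splits)
  qed
  \<comment> \<open>With \<open>F\<close> the factorial of \<open>n - 1\<close>, \<open>R\<close>
    takes the value \<open>n * n * F\<close> at 0 and \<open>D 0\<close> the value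
    \<open>F\<close>.\<close>
  moreover have "c 0 = (real n)\<^sup>2"
  proof -
    define F where "F = (\<Prod>i\<in>{1..<n}. real i)"
    have "F \<noteq> 0" by (auto simp: F_def)
    have "(\<Prod>i\<in>{1..<n}. - (1 + real i)) = (-1) ^ (n - 1) * (\<Prod>i\<in>{1..<n}. 1 + real i)"
      by (simp only: prod_uminus card_atLeastLessThan)
    moreover have "(\<Prod>i\<in>{1..<n}. 1 + real i) = real n * F"
    proof -
      have "(\<Prod>i\<in>{1..<n}. 1 + real i) = (\<Prod>i\<in>{Suc 1..<Suc n}. real i)"
        unfolding prod.shift_bounds_Suc_ivl by simp
      also have "\<dots> = (\<Prod>i\<in>{1..<Suc n}. real i)"
        using assms by (subst (2) prod.atLeast_Suc_lessThan) auto
      finally show ?thesis using assms by (simp add: F_def)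
    qed
    ultimately have "poly R 0 = real n * real n * F" by (simp add: R flip: power_add)
    moreover have "{..<n} - {0} = {1..<n}" by auto
    then have "poly (D 0) 0 = F" by (simp add: D F_def)
    ultimately show ?thesis using \<open>F \<noteq> 0\<close> by (simp add: c_def power2_eq_square)
  qed
  ultimately show ?thesis using that by blast
qed

text \<open>The Gram matrix of the monomials on \<open>[0,1]\<close> is the Hilbert matrix.\<close>

lemma has_integral_monomial_product:
  "((\<lambda>t::real. t ^ j * t ^ k) has_integral 1 / (real j + real k + 1)) {0..1}"
proof -
  have "((\<lambda>t. t ^ Suc (j + k) / real (Suc (j + k))) has_real_derivative t ^ (j + k)) (at t within {0..1})"
    for t :: real
    using DERIV_cdivide[OF DERIV_pow[of "Suc (j + k)" t], of "real (Suc (j + k))"]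
    by (simp del: of_nat_Suc)
  then have "((\<lambda>t. t ^ (j + k)) has_integral
    1 ^ Suc (j + k) / real (Suc (j + k)) - 0 ^ Suc (j + k) / real (Suc (j + k))) {0..1::real}"
    by (intro fundamental_theorem_of_calculus)
      (auto simp flip: has_real_derivative_iff_has_vector_derivative)
  then show ?thesis by (simp add: power_add add_ac)
qed

lemma poly_eq_sum_lessThan: "degree p < n \<Longrightarrow> poly p x = (\<Sum>i<n. coeff p i * x ^ i)"
  for p :: "real poly"
  unfolding poly_altdef by (rule sum.mono_neutral_left) (auto simp: coeff_eq_0)

text \<open>The weights of the previous lemma serve as coefficients: integrating \<open>K\<close>
  against \<open>t ^ k\<close> gives 1 for \<open>k = 0\<close> and 0 for \<open>0 < k < n\<close>,
  which is evaluation at 0.\<close>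

lemma polynomial_point_kernel:
  assumes "n \<ge> 1"
  obtains K :: "real poly" where "degree K < n" "poly K 0 = (real n)\<^sup>2"
    "\<And>p. degree p < n \<Longrightarrow> ((\<lambda>t. poly K t * poly p t) has_integral poly p 0) {0..1}"
proof -
  obtain c :: "nat \<Rightarrow> real" where c: "c 0 = (real n)\<^sup>2"
    "\<And>k. k < n \<Longrightarrow> (\<Sum>j<n. c j / (real j + real k + 1)) = (if k = 0 then 1 else 0)"
    using partial_fraction_weights[OF assms] by blast
  define K where "K = (\<Sum>j<n. monom (c j) j)"
  have K: "poly K t = (\<Sum>j<n. c j * t ^ j)" for t
    by (simp add: K_def poly_sum poly_monom)
  have "degree K < n"
    unfolding K_def using assms by (intro degree_sum_less le_less_trans[OF degree_monom_le]) auto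
  moreover have "poly K 0 = (real n)\<^sup>2"
    unfolding K using assms c(1) by (subst sum.remove[of _ 0]) (auto intro!: sum.neutral)
  moreover have "((\<lambda>t. poly K t * poly p t) has_integral poly p 0) {0..1}" if "degree p < n" for p
  proof -
    have "((\<lambda>t. \<Sum>k<n. \<Sum>j<n. coeff p k * c j * (t ^ j * t ^ k)) has_integral
        (\<Sum>k<n. \<Sum>j<n. coeff p k * c j * (1 / (real j + real k + 1)))) {0..1}"
      by (intro has_integral_sum has_integral_mult_right has_integral_monomial_product) auto
    moreover have "(\<Sum>k<n. \<Sum>j<n. coeff p k * c j * (t ^ j * t ^ k)) = poly K t * poly p t" for t
      unfolding K poly_eq_sum_lessThan[OF that] sum_product
      by (subst sum.swap) (simp add: mult_ac)
    moreover have "(\<Sum>k<n. \<Sum>j<n. coeff p k * c j * (1 / (real j + real k + 1))) = poly p 0"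
    proof -
      have "(\<Sum>k<n. \<Sum>j<n. coeff p k * c j * (1 / (real j + real k + 1)))
        = (\<Sum>k<n. coeff p k * (\<Sum>j<n. c j / (real j + real k + 1)))"
        by (simp add: sum_distrib_left)
      also have "\<dots> = (\<Sum>k<n. if k = 0 then coeff p 0 else 0)"
        by (intro sum.cong) (auto simp: c(2))
      finally show ?thesis using assms by (simp add: poly_0_coeff_0)
    qed
    ultimately show ?thesis by simp
  qed
  ultimately show ?thesis using that by blast
qed

text \<open>Cauchy-Schwarz for \<open>p\<close> and \<open>K\<close>, where the integral of the
  square of \<open>K\<close> is its own value at 0.\<close>

lemma polynomial_point_bound:
  fixes p :: "real poly"
  assumes "degree p < n"
  shows "(poly p 0)\<^sup>2 \<le> (real n)\<^sup>2 * integral {0..1} (\<lambda>t. (poly p t)\<^sup>2)"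
proof -
  have n: "n \<ge> 1" using assms by simp
  obtain K :: "real poly" where K: "degree K < n" "poly K 0 = (real n)\<^sup>2"
    "\<And>p. degree p < n \<Longrightarrow> ((\<lambda>t. poly K t * poly p t) has_integral poly p 0) {0..1}"
    using polynomial_point_kernel[OF n] by blast
  \<comment> \<open>The coefficient of the orthogonal projection of \<open>p\<close> onto
    \<open>K\<close>.\<close>
  define s where "s = poly p 0 / (real n)\<^sup>2"
  have "((\<lambda>t. (poly p t)\<^sup>2) has_integral integral {0..1} (\<lambda>t. (poly p t)\<^sup>2)) {0..1}"
    by (intro integrable_integral integrable_continuous_real continuous_intros)
  from has_integral_add[OF has_integral_diff[OF this has_integral_mult_right[OF K(3)[OF assms], of "2 * s"]]
      has_integral_mult_right[OF K(3)[OF K(1)], of "s\<^sup>2"]]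
  moreover have "(poly p t)\<^sup>2 - 2 * s * (poly K t * poly p t) + s\<^sup>2 * (poly K t * poly K t) =
    (poly p t - s * poly K t)\<^sup>2" for t
    by (simp add: power2_eq_square algebra_simps)
  ultimately have "((\<lambda>t. (poly p t - s * poly K t)\<^sup>2) has_integral
    integral {0..1} (\<lambda>t. (poly p t)\<^sup>2) - 2 * s * poly p 0 + s\<^sup>2 * (real n)\<^sup>2) {0..1}"
    unfolding K(2) by simp
  then have "0 \<le> integral {0..1} (\<lambda>t. (poly p t)\<^sup>2) - 2 * s * poly p 0 + s\<^sup>2 * (real n)\<^sup>2"
    by (rule has_integral_nonneg) simp
  also have "\<dots> = integral {0..1} (\<lambda>t. (poly p t)\<^sup>2) - (poly p 0)\<^sup>2 / (real n)\<^sup>2"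
    using n by (simp add: s_def field_simps power2_eq_square)
  finally show ?thesis using n by (simp add: field_simps)
qed

subsection \<open>The extremal exponential sum\<close>

text \<open>Zeros are isolated, so \<open>f\<close> has a constant sign on each side of
  \<open>s\<close>; equal signs give the first alternative, opposite signs the second.\<close>

lemma locally_signed_even_or_odd:
  assumes cont: "\<And>x. isCont f x" and fin: "finite {x. f x = 0}"
  shows "locally_signed f s \<or> locally_signed (\<lambda>x. (x - s) * f x) s"
proof (cases "f s = 0")
  case False
  then show ?thesis using locally_signed_nonzero cont by blast
next
  case True
  obtain d where "d > 0" and d: "\<And>x. f x = 0 \<Longrightarrow> x \<noteq> s \<Longrightarrow> d \<le> dist s x"
    using finite_set_avoid[OF fin, of s] by auto
  have nz: "f x \<noteq> 0" if "\<bar>x - s\<bar> < d" "x \<noteq> s" for x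
    using d[of x] that by (auto simp: dist_real_def)
  have sgn: "(\<forall>x\<in>S. f x \<ge> 0) \<or> (\<forall>x\<in>S. f x \<le> 0)"
    if "S = {s<..<s+d} \<or> S = {s-d<..<s}" for S
  proof (rule locally_signed_imp_signed)
    have *: "f x \<noteq> 0" if "x \<in> S" for x
      using \<open>S = _ \<or> S = _\<close> that by (intro nz) auto
    then show "finite {x \<in> S. f x = 0}" by (metis (mono_tags, lifting) empty_Collect_eq finite.emptyI)
    show "locally_signed f x" if "x \<in> S" for x
      using locally_signed_nonzero[OF cont *[OF that]] .
  qed (use that in auto)
  have near: "\<forall>\<^sub>F x in nhds s. P x" if "\<And>x. \<bar>x - s\<bar> < d \<Longrightarrow> P x" for P
    using that \<open>d > 0\<close> by (auto simp: eventually_nhds_metric dist_real_def)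
  have R: "x \<in> {s<..<s+d} \<or> x \<in> {s-d<..<s} \<or> x = s" if "\<bar>x - s\<bar> < d" for x
    using that by auto
  consider (pp) "\<forall>x\<in>{s<..<s+d}. f x \<ge> 0" "\<forall>x\<in>{s-d<..<s}. f x \<ge> 0"
    | (pn) "\<forall>x\<in>{s<..<s+d}. f x \<ge> 0" "\<forall>x\<in>{s-d<..<s}. f x \<le> 0"
    | (np) "\<forall>x\<in>{s<..<s+d}. f x \<le> 0" "\<forall>x\<in>{s-d<..<s}. f x \<ge> 0"
    | (nn) "\<forall>x\<in>{s<..<s+d}. f x \<le> 0" "\<forall>x\<in>{s-d<..<s}. f x \<le> 0"
    using sgn by blast
  then show ?thesis
  proof cases
    case pp
    then have "f x \<ge> 0" if "\<bar>x - s\<bar> < d" for x using R[OF that] True by auto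
    then show ?thesis unfolding locally_signed_def using near[of "\<lambda>x. f x \<ge> 0"] by blast
  next
    case nn
    then have "f x \<le> 0" if "\<bar>x - s\<bar> < d" for x using R[OF that] True by auto
    then show ?thesis unfolding locally_signed_def using near[of "\<lambda>x. f x \<le> 0"] by blast
  next
    case pn
    then have "(x - s) * f x \<ge> 0" if "\<bar>x - s\<bar> < d" for x
      using R[OF that] True by (auto simp: zero_le_mult_iff)
    then show ?thesis unfolding locally_signed_def using near[of "\<lambda>x. (x - s) * f x \<ge> 0"] by blast
  next
    case np
    then have "(x - s) * f x \<le> 0" if "\<bar>x - s\<bar> < d" for x
      using R[OF that] True by (auto simp: mult_le_0_iff)
    then show ?thesis unfolding locally_signed_def using near[of "\<lambda>x. (x - s) * f x \<le> 0"] by blast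
  qed
qed

lemma integral_zero_nonneg_imp_zero:
  fixes F :: "real \<Rightarrow> real"
  assumes "continuous_on {0..1} F" "\<And>x. x \<in> {0<..<1} \<Longrightarrow> F x \<ge> 0" "integral {0..1} F = 0"
    "x \<in> {0..1}"
  shows "F x = 0"
proof -
  have "F x \<ge> 0" if "x \<in> {0..1}" for x
    using continuous_ge_on_closure[of "{0<..<1}" F x 0] assms(1,2) that by simp
  then show ?thesis
    using integral_eq_0_iff[OF assms(1)] assms(3,4) by auto
qed

text \<open>If there were fewer zeros, some \<open>g\<close> in the span would vanish exactly at \<open>0\<close> and at the sign changes of \<open>f\<close>;
  then \<open>f g\<close> would have constant sign, against orthogonality.\<close>
lemma expsum_orthogonal_zeros:
  assumes E: "finite E" and nz: "\<exists>l\<in>E. a l \<noteq> 0"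
    and orth: "\<And>d. expsum E d 0 = 0 \<Longrightarrow> integral {0..1} (\<lambda>t. expsum E a t * expsum E d t) = 0"
  obtains Z where "finite Z" "Z \<subseteq> {0<..<1}" "card E = Suc (card Z)"
    "\<And>z. z \<in> Z \<Longrightarrow> expsum E a z = 0"
proof -
  define f where "f = expsum E a"
  have finf: "finite {t. f t = 0}" unfolding f_def using expsum_zeros_finite[OF E nz] .
  define S where "S = {s\<in>{0<..<1}. f s = 0}"
  have S: "finite S" unfolding S_def by (rule finite_subset[OF _ finf]) auto
  have "card S < card E"
    using expsum_zero_count[OF E nz S, of "{}"] by (auto simp: S_def f_def)
  moreover have "\<not> Suc (card S) < card E"
  proof
    assume less: "Suc (card S) < card E"
    \<comment> \<open>The zeros in \<open>(0,1)\<close> where \<open>f\<close> changes sign. Zeros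
      without sign change are left out, as \<open>g\<close> must not change sign there.\<close>
    define Od where "Od = {s\<in>S. locally_signed (\<lambda>x. (x - s) * f x) s}"
    have "Od \<subseteq> S" by (auto simp: Od_def)
    then have Od: "finite Od" "card Od \<le> card S" "0 \<notin> Od"
      using S card_mono[OF S, of Od] finite_subset by (auto simp: S_def)
    have Z: "finite (insert 0 Od)" "card (insert 0 Od) = Suc (card Od)" using Od by auto
    \<comment> \<open>Exactly one exponent more than prescribed zeros, so that \<open>g\<close> has
      no other zeros and all of them are simple.\<close>
    obtain E2 where E2: "E2 \<subseteq> E" "card E2 = Suc (card (insert 0 Od))"
      using obtain_subset_with_card_n[of "Suc (Suc (card Od))" E] less Od by auto
    have finE2: "finite E2" using E2(1) E by (rule finite_subset)
    obtain b where b: "\<exists>l\<in>E2. b l \<noteq> 0" "\<And>z. z \<in> insert 0 Od \<Longrightarrow> expsum E2 b z = 0"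
      using expsum_vanishing_exists[OF finE2 Z(1)] E2(2) by (metis lessI)
    define g where "g = expsum E2 b"
    have g_iff: "g t = 0 \<longleftrightarrow> t \<in> insert 0 Od" for t
      unfolding g_def using expsum_simple_zeros(2)[OF finE2 b(1) Z(1) b(2) E2(2)] .
    have g_odd: "locally_signed (\<lambda>x. (x - s) * g x) s" if "s \<in> Od" for s
      unfolding g_def using expsum_simple_zeros(1)[OF finE2 b(1) Z(1) b(2) E2(2)] b(2) that
      by (intro expsum_locally_signed_simple_zero) auto
    define F where "F = (\<lambda>x. f x * g x)"
    have cont: "isCont f x" "isCont g x" for x by (simp_all add: f_def g_def isCont_expsum)
    have contF: "continuous_on X F" for X
      unfolding F_def f_def g_def by (intro continuous_intros)
    have finF: "finite {x. F x = 0}"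
      using finf Z(1) by (rule rev_finite_subset[OF finite_UnI]) (auto simp: F_def g_iff)
    have "locally_signed F s" if s: "s \<in> {0<..<1}" for s
    proof (cases "s \<in> Od")
      case True
      then have "locally_signed (\<lambda>x. (x - s) * f x) s" "f s = 0" by (auto simp: Od_def S_def)
      then show ?thesis unfolding F_def using locally_signed_mult_odd g_odd[OF True] by blast
    next
      case False
      have "locally_signed f s"
      proof (cases "f s = 0")
        case True
        then have "\<not> locally_signed (\<lambda>x. (x - s) * f x) s"
          using False s by (auto simp: Od_def S_def)
        then show ?thesis using locally_signed_even_or_odd[OF cont(1) finf] by blast
      qed (use locally_signed_nonzero cont in blast)
      moreover have "locally_signed g s"
        using False s g_iff[of s] cont by (intro locally_signed_nonzero) auto
      ultimately show ?thesis unfolding F_def by (rule locally_signed_mult)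
    qed
    moreover have "finite {x\<in>{0<..<1}. F x = 0}" by (rule finite_subset[OF _ finF]) auto
    ultimately have "(\<forall>x\<in>{0<..<1}. F x \<ge> 0) \<or> (\<forall>x\<in>{0<..<1}. F x \<le> 0)"
      by (intro locally_signed_imp_signed) auto
    moreover have int: "integral {0..1} F = 0"
    proof -
      have "expsum E (\<lambda>l. if l \<in> E2 then b l else 0) t = g t" for t
        unfolding g_def by (rule expsum_extend[OF E E2(1)])
      then show ?thesis
        using orth[of "\<lambda>l. if l \<in> E2 then b l else 0"] g_iff[of 0] by (simp add: F_def f_def)
    qed
    ultimately have "F x = 0" if "x \<in> {0..1}" for x
    proof (elim disjE)
      assume "\<forall>x\<in>{0<..<1}. F x \<ge> 0"
      then show ?thesis using integral_zero_nonneg_imp_zero[of F x] contF int that by auto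
    next
      assume "\<forall>x\<in>{0<..<1}. F x \<le> 0"
      then show ?thesis
        using integral_zero_nonneg_imp_zero[of "\<lambda>x. - F x" x] contF int that
        by (auto intro: continuous_intros)
    qed
    then have "{0..1} \<subseteq> {x. F x = 0}" by auto
    then have "finite {0..1::real}" using finF finite_subset by blast
    then show False by (simp add: infinite_Icc)
  qed
  ultimately have "card E = Suc (card S)" by simp
  moreover have "S \<subseteq> {0<..<1}" "\<And>z. z \<in> S \<Longrightarrow> expsum E a z = 0" by (auto simp: S_def f_def)
  ultimately show ?thesis using that S by blast
qed

text \<open>The sums vanishing at 0 are spanned by the differences
  \<open>exp (l * t) - exp (e * t)\<close>, so orthogonality amounts to one linear condition fewer
  than there are coefficients.\<close>

lemma expsum_orthogonal_exists:
  assumes E: "finite E" "E \<noteq> {}"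
  obtains a where "\<exists>l\<in>E. a l \<noteq> 0"
    "\<And>d. expsum E d 0 = 0 \<Longrightarrow> integral {0..1} (\<lambda>t. expsum E a t * expsum E d t) = 0"
proof -
  obtain e where e: "e \<in> E" using E by blast
  define A where "A = (\<lambda>l m. integral {0..1} (\<lambda>t. exp (m * t) * (exp (l * t) - exp (e * t))))"
  have A: "((\<lambda>t. exp (m * t) * (exp (l * t) - exp (e * t))) has_integral A l m) {0..1}" for l m
    unfolding A_def by (intro integrable_integral integrable_continuous_real continuous_intros)
  have "card (E - {e}) < card E" using E e by (intro psubset_card_mono) auto
  then obtain a where a: "\<exists>l\<in>E. a l \<noteq> 0" "\<And>l. l \<in> E - {e} \<Longrightarrow> (\<Sum>m\<in>E. A l m * a m) = 0"
    using underdetermined_system[of "E - {e}" E A] E by auto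
  have "integral {0..1} (\<lambda>t. expsum E a t * expsum E d t) = 0" if "expsum E d 0 = 0" for d
  proof -
    have de: "d e = - (\<Sum>l\<in>E - {e}. d l)"
      using that E e by (simp add: expsum_def sum.remove[of E e])
    have d: "expsum E d t = (\<Sum>l\<in>E - {e}. d l * (exp (l * t) - exp (e * t)))" for t
      using E e by (simp add: expsum_def sum.remove[of E e] de sum_distrib_right
          right_diff_distrib sum_subtractf)
    have "((\<lambda>t. \<Sum>l\<in>E - {e}. d l * (\<Sum>m\<in>E. a m * (exp (m * t) * (exp (l * t) - exp (e * t)))))
      has_integral (\<Sum>l\<in>E - {e}. d l * (\<Sum>m\<in>E. a m * A l m))) {0..1}"
      using E by (intro has_integral_sum has_integral_mult_right A) auto
    moreover have "(\<Sum>l\<in>E - {e}. d l * (\<Sum>m\<in>E. a m * (exp (m * t) * (exp (l * t) - exp (e * t)))))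
      = expsum E a t * expsum E d t" for t
      unfolding d unfolding expsum_def sum_distrib_left sum_distrib_right
      by (simp add: mult_ac)
    moreover have "(\<Sum>l\<in>E - {e}. d l * (\<Sum>m\<in>E. a m * A l m)) = 0"
      using a(2) by (intro sum.neutral) (simp add: mult.commute)
    ultimately show ?thesis by (simp add: integral_unique)
  qed
  then show ?thesis using that[of a] a(1) by blast
qed

text \<open>First the orthogonal sum \<open>f\<close> is bounded through the polynomial
  \<open>p\<close> it dominates. A general sum is \<open>c * f + r\<close> with \<open>r\<close>
  vanishing at 0 and hence orthogonal to \<open>f\<close>, so by Pythagoras \<open>r\<close> only
  enlarges the norm.\<close>

lemma expsum_point_bound:
  assumes E: "finite E" "E \<noteq> {}" "\<And>l. l \<in> E \<Longrightarrow> l \<ge> 0"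
  shows "(expsum E b 0)\<^sup>2 \<le> (real (card E))\<^sup>2 * integral {0..1} (\<lambda>t. (expsum E b t)\<^sup>2)"
proof -
  obtain a where nz: "\<exists>l\<in>E. a l \<noteq> 0" and
    orth: "\<And>d. expsum E d 0 = 0 \<Longrightarrow> integral {0..1} (\<lambda>t. expsum E a t * expsum E d t) = 0"
    using expsum_orthogonal_exists[OF E(1,2)] by blast
  obtain Z where Z: "finite Z" "Z \<subseteq> {0<..<1}" "card E = Suc (card Z)"
    "\<And>z. z \<in> Z \<Longrightarrow> expsum E a z = 0"
    using expsum_orthogonal_zeros[OF E(1) nz orth] by blast
  define f where "f = expsum E a"
  have pos: "z > 0" if "z \<in> Z" for z using that Z(2) by auto
  have f0: "f 0 \<noteq> 0"
    unfolding f_def using expsum_simple_zeros(2)[OF E(1) nz Z(1,4,3), of 0] pos by auto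
  \<comment> \<open>The polynomial with zeros \<open>Z\<close> and value \<open>f 0\<close> at 0;
    its degree is below \<open>card E\<close>.\<close>
  define p where "p = smult (f 0) (\<Prod>z\<in>Z. [:1, - 1 / z:])"
  have "degree p \<le> (\<Sum>z\<in>Z. 1)"
    unfolding p_def
    by (intro order_trans[OF degree_smult_le] order_trans[OF degree_prod_sum_le[OF Z(1)]] sum_mono) auto
  then have deg: "degree p < card E" using Z(3) by simp
  have p: "poly p t = f 0 * (\<Prod>z\<in>Z. 1 - t / z)" for t
    by (simp add: p_def poly_prod)
  have "\<bar>poly p t\<bar> \<le> \<bar>f t\<bar>" if "t \<ge> 0" for t
    using expsum_ge_polynomial_product[OF E(1,3) Z(1) pos Z(3) nz Z(4) that]
    by (simp add: p abs_mult abs_prod f_def)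
  then have "(poly p t)\<^sup>2 \<le> (f t)\<^sup>2" if "t \<ge> 0" for t using that abs_le_square_iff by blast
  then have le: "integral {0..1} (\<lambda>t. (poly p t)\<^sup>2) \<le> integral {0..1} (\<lambda>t. (f t)\<^sup>2)"
    unfolding f_def
    by (intro integral_le integrable_continuous_real continuous_intros) auto
  have "(f 0)\<^sup>2 \<le> (real (card E))\<^sup>2 * integral {0..1} (\<lambda>t. (poly p t)\<^sup>2)"
    using polynomial_point_bound[OF deg] by (simp add: p)
  also have "\<dots> \<le> (real (card E))\<^sup>2 * integral {0..1} (\<lambda>t. (f t)\<^sup>2)"
    using le by (intro mult_left_mono) auto
  finally have f_bound: "(f 0)\<^sup>2 \<le> (real (card E))\<^sup>2 * integral {0..1} (\<lambda>t. (f t)\<^sup>2)" .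

  \<comment> \<open>Chosen so that the remainder \<open>r\<close> vanishes at 0.\<close>
  define c where "c = expsum E b 0 / f 0"
  define r where "r = expsum E (\<lambda>l. b l - c * a l)"
  have r: "expsum E b t = c * f t + r t" for t
    by (simp add: r_def f_def expsum_diff expsum_cmult)
  have "r 0 = 0" using r[of 0] f0 by (simp add: c_def)
  then have fr: "integral {0..1} (\<lambda>t. f t * r t) = 0"
    using orth[of "\<lambda>l. b l - c * a l"] by (simp add: r_def f_def)
  have int: "(\<lambda>t. (f t)\<^sup>2) integrable_on {0..1}" "(\<lambda>t. (r t)\<^sup>2) integrable_on {0..1}"
    "(\<lambda>t. f t * r t) integrable_on {0..1}"
    unfolding f_def r_def by (intro integrable_continuous_real continuous_intros)+
  have "((\<lambda>t. c\<^sup>2 * (f t)\<^sup>2 + 2 * c * (f t * r t) + (r t)\<^sup>2) has_integral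
    c\<^sup>2 * integral {0..1} (\<lambda>t. (f t)\<^sup>2) + 2 * c * integral {0..1} (\<lambda>t. f t * r t)
      + integral {0..1} (\<lambda>t. (r t)\<^sup>2)) {0..1}"
    by (intro has_integral_add has_integral_mult_right integrable_integral int)
  moreover have "c\<^sup>2 * (f t)\<^sup>2 + 2 * c * (f t * r t) + (r t)\<^sup>2 = (expsum E b t)\<^sup>2" for t
    by (simp add: r power2_eq_square algebra_simps)
  ultimately have "integral {0..1} (\<lambda>t. (expsum E b t)\<^sup>2) =
    c\<^sup>2 * integral {0..1} (\<lambda>t. (f t)\<^sup>2) + integral {0..1} (\<lambda>t. (r t)\<^sup>2)"
    using fr by (simp add: integral_unique)
  moreover have "integral {0..1} (\<lambda>t. (r t)\<^sup>2) \<ge> 0" using int by (intro integral_nonneg) auto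
  ultimately have ge: "integral {0..1} (\<lambda>t. (expsum E b t)\<^sup>2) \<ge> c\<^sup>2 * integral {0..1} (\<lambda>t. (f t)\<^sup>2)"
    by simp
  have "(expsum E b 0)\<^sup>2 = c\<^sup>2 * (f 0)\<^sup>2" using f0 by (simp add: c_def power_divide)
  also have "\<dots> \<le> c\<^sup>2 * ((real (card E))\<^sup>2 * integral {0..1} (\<lambda>t. (f t)\<^sup>2))"
    using f_bound by (intro mult_left_mono) auto
  also have "\<dots> \<le> (real (card E))\<^sup>2 * integral {0..1} (\<lambda>t. (expsum E b t)\<^sup>2)"
    using mult_left_mono[OF ge, of "(real (card E))\<^sup>2"] by (simp add: mult_ac)
  finally show ?thesis .
qed

subsection \<open>The bound and its sharpness\<close>

lemma exp_sum_eq_expsum: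
  assumes "admissible_exps n lam"
  shows "card (lam ` {..<n}) = n"
    "exp_sum n a lam t = expsum (lam ` {..<n}) (\<lambda>l. a (the_inv_into {..<n} lam l)) t"
proof -
  have inj: "inj_on lam {..<n}"
    using assms unfolding admissible_exps_def inj_on_def
    by (metis lessThan_iff linorder_neqE_nat order_less_irrefl)
  show "card (lam ` {..<n}) = n" using card_image[OF inj] by simp
  show "exp_sum n a lam t = expsum (lam ` {..<n}) (\<lambda>l. a (the_inv_into {..<n} lam l)) t"
    unfolding exp_sum_def expsum_def sum.reindex[OF inj]
    by (intro sum.cong) (auto simp: the_inv_into_f_f[OF inj])
qed

lemma exp_sum_point_bound:
  assumes "n \<ge> 1" "admissible_exps n lam"
  shows "\<bar>exp_sum n a lam 0\<bar> \<le> real n * L2_norm01 (exp_sum n a lam)"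
proof -
  have "(exp_sum n a lam 0)\<^sup>2 \<le> (real n)\<^sup>2 * integral {0..1} (\<lambda>t. (exp_sum n a lam t)\<^sup>2)"
    using expsum_point_bound[of "lam ` {..<n}"] assms
    unfolding exp_sum_eq_expsum[OF assms(2)]
    by (auto simp: exp_sum_eq_expsum(1) lessThan_empty_iff admissible_exps_def)
  from real_sqrt_le_mono[OF this] show ?thesis
    by (simp add: L2_norm01_def real_sqrt_mult)
qed

section \<open>Sharpness: exponential sums approximating the polynomial kernel\<close>

text \<open>A polynomial in \<open>exp (\<epsilon> * t)\<close> has the exponents
  \<open>0, \<epsilon>, \<dots>, (n - 1) * \<epsilon>\<close>. The substitution fixes 0, so the
  value at 0 remains that of \<open>K\<close>.\<close>

lemma polynomial_as_exp_sum:
  fixes K :: "real poly"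
  assumes "degree K < n" "\<epsilon> > 0"
  obtains a where "\<And>t. exp_sum n a (\<lambda>j. \<epsilon> * real j) t = poly K ((exp (\<epsilon> * t) - 1) / \<epsilon>)"
    "admissible_exps n (\<lambda>j. \<epsilon> * real j)"
proof -
  define q where "q = pcompose K [:- 1 / \<epsilon>, 1 / \<epsilon>:]"
  have deg: "degree q < n" using assms by (simp add: q_def degree_pcompose)
  have "exp_sum n (coeff q) (\<lambda>j. \<epsilon> * real j) t = poly K ((exp (\<epsilon> * t) - 1) / \<epsilon>)" for t
  proof -
    have "exp_sum n (coeff q) (\<lambda>j. \<epsilon> * real j) t = poly q (exp (\<epsilon> * t))"
      unfolding poly_eq_sum_lessThan[OF deg] exp_sum_def
      by (simp add: exp_of_nat_mult[symmetric] mult_ac)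
    then show ?thesis by (simp add: q_def poly_pcompose diff_divide_distrib)
  qed
  moreover have "admissible_exps n (\<lambda>j. \<epsilon> * real j)"
    using assms(2) by (simp add: admissible_exps_def)
  ultimately show ?thesis using that by blast
qed

text \<open>Dominated convergence: the arguments converge pointwise to \<open>t\<close> and stay in
  the compact interval \<open>[0,2]\<close>, where the square of \<open>K\<close> is
  bounded.\<close>

lemma integral_polynomial_exp_tendsto:
  fixes K :: "real poly"
  shows "(\<lambda>m. integral {0..1} (\<lambda>t. (poly K ((exp (inverse (real (Suc m)) * t) - 1) / inverse (real (Suc m))))\<^sup>2))
    \<longlonglongrightarrow> integral {0..1} (\<lambda>t. (poly K t)\<^sup>2)"
proof -
  define y where "y = (\<lambda>m t. (exp (inverse (real (Suc m)) * t) - 1) / inverse (real (Suc m)))"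
  have "compact ((\<lambda>x. (poly K x)\<^sup>2) ` {0..2})"
    by (intro compact_continuous_image continuous_intros) simp
  then obtain C where C: "\<And>x. x \<in> {0..2} \<Longrightarrow> norm ((poly K x)\<^sup>2) \<le> C"
    by (metis bounded_iff compact_imp_bounded image_eqI)
  \<comment> \<open>The endpoint 2 comes from
    \<open>exp u - 1 \<le> u + u\<^sup>2 \<le> 2 * u\<close> for \<open>u\<close> in
    \<open>[0,1]\<close>.\<close>
  have y: "y m t \<in> {0..2}" if "t \<in> {0..1}" for m t
  proof -
    define u where "u = inverse (real (Suc m)) * t"
    have m: "inverse (real (Suc m)) > 0" "inverse (real (Suc m)) \<le> 1"
      by (simp_all add: inverse_le_1_iff)
    then have u: "0 \<le> u" "u \<le> 1" "u \<le> inverse (real (Suc m))"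
      using that mult_mono[of "inverse (real (Suc m))" 1 t 1]
        mult_left_mono[of t 1 "inverse (real (Suc m))"] by (auto simp: u_def simp del: of_nat_Suc)
    have "exp u \<le> 1 + u + u\<^sup>2" using u by (intro exp_bound) auto
    also have "u\<^sup>2 \<le> u" using u by (simp add: power2_eq_square mult_left_le)
    finally have "exp u - 1 \<le> 2 * inverse (real (Suc m))" using u by linarith
    moreover have "exp u \<ge> 1" using u by simp
    ultimately show ?thesis using m(1)
      by (simp add: y_def flip: u_def del: of_nat_Suc) (simp add: field_simps)
  qed
  have lim: "(\<lambda>m. y m t) \<longlonglongrightarrow> t" for t
    unfolding y_def by real_asymp
  have "(\<lambda>m. integral {0..1} (\<lambda>t. (poly K (y m t))\<^sup>2)) \<longlonglongrightarrow> integral {0..1} (\<lambda>t. (poly K t)\<^sup>2)"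
  proof (rule dominated_convergence(2)[where h = "\<lambda>_. C"])
    show "(\<lambda>t. (poly K (y m t))\<^sup>2) integrable_on {0..1}" for m
      unfolding y_def by (intro integrable_continuous_real continuous_intros) auto
    show "norm ((poly K (y m t))\<^sup>2) \<le> C" if "t \<in> {0..1}" for m t
      using C y[OF that] .
    show "(\<lambda>m. (poly K (y m t))\<^sup>2) \<longlonglongrightarrow> (poly K t)\<^sup>2" for t
      by (intro tendsto_power tendsto_poly lim)
  qed auto
  then show ?thesis by (simp add: y_def)
qed

lemma exp_sum_sharp_sequence:
  assumes "n \<ge> 1"
  obtains a lam where "\<And>m. admissible_exps n (lam m)" "\<And>m. exp_sum n (a m) (lam m) 0 = (real n)\<^sup>2"
    "(\<lambda>m. \<bar>exp_sum n (a m) (lam m) 0\<bar> / L2_norm01 (exp_sum n (a m) (lam m))) \<longlonglongrightarrow> real n"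
proof -
  obtain K :: "real poly" where K: "degree K < n" "poly K 0 = (real n)\<^sup>2"
    "\<And>p. degree p < n \<Longrightarrow> ((\<lambda>t. poly K t * poly p t) has_integral poly p 0) {0..1}"
    using polynomial_point_kernel[OF assms] by blast
  define lam where "lam = (\<lambda>m j. inverse (real (Suc m)) * real j)"
  have "\<exists>a. (\<forall>t. exp_sum n a (lam m) t =
      poly K ((exp (inverse (real (Suc m)) * t) - 1) / inverse (real (Suc m)))) \<and> admissible_exps n (lam m)" for m
    using polynomial_as_exp_sum[OF K(1), of "inverse (real (Suc m))"] unfolding lam_def
    by (metis inverse_positive_iff_positive of_nat_0_less_iff zero_less_Suc)
  then obtain a where a: "\<And>m t. exp_sum n (a m) (lam m) t =
      poly K ((exp (inverse (real (Suc m)) * t) - 1) / inverse (real (Suc m)))"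
    "\<And>m. admissible_exps n (lam m)" by metis
  have a0: "exp_sum n (a m) (lam m) 0 = (real n)\<^sup>2" for m by (simp add: a(1) K(2))
  \<comment> \<open>The reproducing property applied to \<open>K\<close> itself; the limiting ratio
    is therefore \<open>n\<^sup>2 / n\<close>.\<close>
  have "integral {0..1} (\<lambda>t. (poly K t)\<^sup>2) = (real n)\<^sup>2"
    using K(3)[OF K(1)] K(2) by (simp add: power2_eq_square integral_unique)
  then have "(\<lambda>m. integral {0..1} (\<lambda>t. \<bar>exp_sum n (a m) (lam m) t\<bar>\<^sup>2)) \<longlonglongrightarrow> (real n)\<^sup>2"
    using integral_polynomial_exp_tendsto[of K] unfolding power2_abs a(1) by simp
  then have "(\<lambda>m. L2_norm01 (exp_sum n (a m) (lam m))) \<longlonglongrightarrow> sqrt ((real n)\<^sup>2)"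
    unfolding L2_norm01_def by (rule tendsto_real_sqrt)
  then have "(\<lambda>m. \<bar>exp_sum n (a m) (lam m) 0\<bar> / L2_norm01 (exp_sum n (a m) (lam m)))
      \<longlonglongrightarrow> (real n)\<^sup>2 / sqrt ((real n)\<^sup>2)"
    unfolding a0 using assms by (intro tendsto_divide) auto
  moreover have "(real n)\<^sup>2 / sqrt ((real n)\<^sup>2) = real n" using assms by (simp add: power2_eq_square)
  ultimately show ?thesis using that[of lam a] a(2) a0 by simp
qed

theorem theorem4p1:
  fixes n :: nat
  assumes "n \<ge> 1"
  shows "(\<forall>a lam. admissible_exps n lam \<longrightarrow>
            \<bar>exp_sum n a lam 0\<bar> \<le> real n * L2_norm01 (exp_sum n a lam))
       \<and> Sup {\<bar>exp_sum n a lam 0\<bar> / L2_norm01 (exp_sum n a lam) | a lam.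
                admissible_exps n lam \<and> exp_sum n a lam \<noteq> (\<lambda>t. 0)} = real n"
    (is "?bound \<and> Sup ?S = _")
proof
  show bound: ?bound using exp_sum_point_bound[OF assms] by blast
  obtain a lam where seq: "\<And>m. admissible_exps n (lam m)"
    "\<And>m. exp_sum n (a m) (lam m) 0 = (real n)\<^sup>2"
    "(\<lambda>m. \<bar>exp_sum n (a m) (lam m) 0\<bar> / L2_norm01 (exp_sum n (a m) (lam m))) \<longlonglongrightarrow> real n"
    by (rule exp_sum_sharp_sequence[OF assms]) (rule that)
  have mem: "\<bar>exp_sum n (a m) (lam m) 0\<bar> / L2_norm01 (exp_sum n (a m) (lam m)) \<in> ?S" for m
  proof -
    have "exp_sum n (a m) (lam m) \<noteq> (\<lambda>t. 0)" using seq(2)[of m] assms by auto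
    then show ?thesis using seq(1) by blast
  qed
  have upper: "x \<le> real n" if x: "x \<in> ?S" for x
  proof -
    obtain b mu where b: "x = \<bar>exp_sum n b mu 0\<bar> / L2_norm01 (exp_sum n b mu)" "admissible_exps n mu"
      using x by blast
    have "L2_norm01 (exp_sum n b mu) \<ge> 0"
      unfolding L2_norm01_def exp_sum_def
      by (intro real_sqrt_ge_zero integral_nonneg integrable_continuous_real continuous_intros) auto
    moreover have "\<bar>exp_sum n b mu 0\<bar> \<le> real n * L2_norm01 (exp_sum n b mu)"
      using bound b(2) by blast
    \<comment> \<open>A vanishing norm would make the quotient 0 by the convention for division,
      which respects the bound.\<close>
    ultimately show ?thesis
      unfolding b(1) by (cases "L2_norm01 (exp_sum n b mu) = 0") (auto simp: divide_le_eq)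
  qed
  show "Sup ?S = real n"
  proof (rule antisym)
    show "Sup ?S \<le> real n" using mem upper by (intro cSup_least) blast+
    have "bdd_above ?S" using upper by (meson bdd_aboveI)
    \<comment> \<open>Every term of the convergent sequence is at most the supremum, hence so is its
      limit.\<close>
    then show "real n \<le> Sup ?S"
      using mem by (intro LIMSEQ_le_const2[OF seq(3)] exI[of _ 0] allI impI cSup_upper)
  qed
qed

end
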